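(* Let $f$ satisfy the growth condition $|f(x)|\leq Kx^{m\operatorname{Re}\rho}e^{x/\beta}$ for all $x>T$, where $K,T,\beta$ are positive constants. Then $$\mathfrak M\big[\mathcal M_{\rho,m}[e^{-ax}f(x)](u\omega,v,\omega),\,u\to z\big]=\Gamma(z)\,\mathcal M_{\rho,m}[x^{-z}f(x)](a\omega,v,\omega),\qquad a>0,$$ where $\mathfrak M$ is the Mellin transform, taken with respect to $u$ and evaluated at $z$.
   Context: Here $\rho\in\mathbb C$ with $\operatorname{Re}\rho>0$, $m\in\mathbb N=\{1,2,\dots\}$, $v\in\mathbb C$ and $\omega\in\mathbb R^+$ (positive reals). For $u,v\in\mathbb C$, $\omega\in\mathbb R^+$ and a function $f$ on $(0,\infty)$, $$\mathcal M_{\rho,m}[f(x)](u,v,\omega)=\int_0^\infty \frac{e^{-ux-v/x}}{(x^m+\omega^m)^\rho}f(\omega x)\,dx,$$ where $x$ inside the brackets is a dummy variable. The Mellin transform of $h$ is $\mathfrak M[h(u)](z)=\int_0^\infty u^{z-1}h(u)\,du$, $\operatorname{Re}z>0$. $\Gamma$ is the gamma function.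
   Formalization: Added assumptions: f is measurable, and the integral on the right converges absolutely where ωx ≤ T, and also where ωx > T if a ≤ 1/β; without these it may be undefined (e.g. f = 1, v = -1). Integrals are read as absolutely convergent and Re z > 0. *)

theory Defs
  imports "HOL-Analysis.Analysis"
begin

text \<open>
  All powers with a complex exponent have a positive real base, so they are the principal ones.
  Integrals over \<open>(0,\<infinity>)\<close> are gauge integrals, which agree with the Lebesgue integral
  whenever the integrand is absolutely integrable.
\<close>

definition M_integrand ::
  "complex \<Rightarrow> nat \<Rightarrow> (real \<Rightarrow> complex) \<Rightarrow> complex \<Rightarrow> complex \<Rightarrow> real \<Rightarrow> real \<Rightarrow> complex"
  where "M_integrand \<rho> m f u v \<omega> x =
    exp (- u * of_real x - v / of_real x) / of_real (x ^ m + \<omega> ^ m) powr \<rho> * f (\<omega> * x)"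

definition M_transform ::
  "complex \<Rightarrow> nat \<Rightarrow> (real \<Rightarrow> complex) \<Rightarrow> complex \<Rightarrow> complex \<Rightarrow> real \<Rightarrow> complex"
  where "M_transform \<rho> m f u v \<omega> = integral {0<..} (M_integrand \<rho> m f u v \<omega>)"

definition M_converges ::
  "complex \<Rightarrow> nat \<Rightarrow> (real \<Rightarrow> complex) \<Rightarrow> complex \<Rightarrow> complex \<Rightarrow> real \<Rightarrow> bool"
  where "M_converges \<rho> m f u v \<omega> \<longleftrightarrow>
    M_integrand \<rho> m f u v \<omega> absolutely_integrable_on {0<..}"

definition mellin :: "(real \<Rightarrow> complex) \<Rightarrow> complex \<Rightarrow> complex"
  where "mellin h z = integral {0<..} (\<lambda>u. of_real u powr (z - 1) * h u)"

definition mellin_converges :: "(real \<Rightarrow> complex) \<Rightarrow> complex \<Rightarrow> bool"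
  where "mellin_converges h z \<longleftrightarrow>
    (\<lambda>u. of_real u powr (z - 1) * h u) absolutely_integrable_on {0<..}"

end

theory Submission
  imports Defs
begin

text \<open>
  Let \<open>g\<close> be the integrand of the transform of \<open>exp (- a x) f(x)\<close> at \<open>u = 0\<close>. The transform at
  \<open>u \<omega>\<close> is the Laplace integral of \<open>g\<close> at \<open>u \<omega>\<close>, and by Fubini its Mellin transform replaces the
  kernel \<open>exp (- u \<omega> x)\<close> by \<open>\<Gamma>(z) (\<omega> x) powr (- z)\<close>. All four claims thus reduce to absolute
  integrability of \<open>(\<omega> x) powr (- z) * g x\<close>. For \<open>a > 1/\<beta>\<close> this holds near infinity because the
  power of \<open>x\<close> in the growth bound is absorbed by the denominator \<open>(x^m + \<omega>^m) powr \<rho>\<close>.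
\<close>

section \<open>Measure-theoretic and elementary preliminaries\<close>

text \<open>Makes Fubini available for the product of two Lebesgue measures. A countable Borel cover
  by sets of finite measure survives completion, since the two measures agree on Borel sets.\<close>

lemma sigma_finite_lebesgue: "sigma_finite_measure (lebesgue :: 'a::euclidean_space measure)"
proof
  obtain A :: "'a set set" where A: "countable A" "A \<subseteq> sets lborel" "\<Union>A = space lborel"
      "\<forall>a\<in>A. emeasure lborel a \<noteq> \<infinity>"
    using lborel.sigma_finite_countable by blast
  then show "\<exists>A::'a set set. countable A \<and> A \<subseteq> sets lebesgue \<and> \<Union>A = space lebesgue \<and>
      (\<forall>a\<in>A. emeasure lebesgue a \<noteq> \<infinity>)"
    by (intro exI[of _ A]) (auto simp: subset_iff)
qed

text \<open>The indicator removes the branch cut along the nonpositive reals, so continuity on the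
  open half-line suffices.\<close>

lemma borel_measurable_powr_pos:
  "(\<lambda>r. indicator {0<..} r *\<^sub>R complex_of_real r powr w) \<in> borel_measurable borel"
  by (rule borel_measurable_continuous_on_indicator)
     (auto intro!: continuous_intros simp: complex_nonpos_Reals_iff)

text \<open>This is \<open>y \<le> exp y\<close> at \<open>y = u * t / p\<close>, raised to the
  power \<open>p\<close>. The bound is uniform in \<open>t\<close>.\<close>

lemma powr_mult_exp_minus_le:
  fixes p u t :: real
  assumes "p > 0" "u > 0" "t > 0"
  shows "t powr p * exp (- (u * t)) \<le> (p / u) powr p"
proof -
  have "u * t / p \<le> exp (u * t / p)"
    using exp_ge_add_one_self[of "u * t / p"] by linarith
  then have "(u * t / p) powr p \<le> exp (u * t / p) powr p"
    using assms by (intro powr_mono2) auto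
  also have "\<dots> = exp (u * t)"
    using assms by (simp add: powr_def)
  finally have "(p / u) powr p * (u * t / p) powr p \<le> (p / u) powr p * exp (u * t)"
    by (intro mult_left_mono) auto
  moreover have "(p / u) powr p * (u * t / p) powr p = t powr p"
    using assms by (subst powr_mult [symmetric]) auto
  ultimately show ?thesis
    by (simp add: exp_minus field_simps)
qed

section \<open>The scaled Gamma integral\<close>

text \<open>Substitute \<open>t = s * u\<close> in Euler's integral. The factor
  \<open>s powr (1 - z)\<close> cancels the \<open>s powr (z - 1)\<close> coming from the integrand,
  and with the Jacobian \<open>1 / s\<close> it leaves \<open>s powr (- z)\<close>.\<close>

lemma has_bochner_integral_Gamma_scaled:
  fixes z :: complex and s :: real
  assumes "Re z > 0" "s > 0"
  shows "has_bochner_integral lebesgue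
    (\<lambda>u. indicator {0<..} u *\<^sub>R (of_real u powr (z - 1) * of_real (exp (- (u * s)))))
    (Gamma z * of_real s powr (- z))"
proof -
  let ?h = "\<lambda>t::real. indicator {0<..} t *\<^sub>R (complex_of_real t powr (z - 1) / of_real (exp t))"
  have abs: "(\<lambda>t. complex_of_real t powr (z - 1) / of_real (exp t)) absolutely_integrable_on {0<..}"
    by (rule absolutely_integrable_Gamma_integral'[OF assms(1)])
  have "has_bochner_integral lebesgue ?h (Gamma z)"
    using abs set_lebesgue_integral_eq_integral(2)[OF abs]
      integral_unique[OF Gamma_integral_complex'[OF assms(1)]]
    by (simp add: has_bochner_integral_iff set_integrable_def set_lebesgue_integral_def)
  then have "has_bochner_integral lebesgue (\<lambda>u. ?h (0 + s * u)) (Gamma z /\<^sub>R \<bar>s\<bar>)"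
    using assms by (subst (asm) has_bochner_integral_lebesgue_real_affine_iff[of s _ _ 0]) auto
  then have "has_bochner_integral lebesgue (\<lambda>u. of_real s powr (1 - z) * ?h (0 + s * u))
      (of_real s powr (1 - z) * (Gamma z /\<^sub>R \<bar>s\<bar>))"
    by (rule has_bochner_integral_mult_right)
  moreover have "of_real s powr (1 - z) * (Gamma z /\<^sub>R \<bar>s\<bar>) = Gamma z * of_real s powr (- z)"
    using assms by (simp add: scaleR_conv_of_real powr_diff powr_minus field_simps)
  moreover have "of_real s powr (1 - z) * ?h (0 + s * u) =
      indicator {0<..} u *\<^sub>R (of_real u powr (z - 1) * of_real (exp (- (u * s))))" for u
  proof (cases "u > 0")
    case True
    have "complex_of_real s powr (1 - z) * of_real s powr (z - 1) = 1"
      using assms by (simp add: powr_add [symmetric])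
    moreover have "complex_of_real (s * u) powr (z - 1) = of_real s powr (z - 1) * of_real u powr (z - 1)"
      using assms True by (simp add: powr_times_real)
    ultimately show ?thesis
      using assms True
      by (simp add: exp_minus divide_inverse mult_ac flip: of_real_mult)
  qed (use assms in \<open>auto simp: zero_less_mult_iff indicator_def\<close>)
  ultimately show ?thesis
    by simp
qed

section \<open>Laplace integrals and their Mellin transforms\<close>

text \<open>The new integrand is the given one times
  \<open>exp (- (u * (c * x))) * (c * x) powr z\<close>, a continuous factor that
  \<open>powr_mult_exp_minus_le\<close> bounds for each fixed \<open>u > 0\<close>.\<close>

lemma absolutely_integrable_exp_mult:
  fixes g :: "real \<Rightarrow> complex" and c u :: real
  assumes "Re z > 0" "c > 0" "u > 0"
    and "(\<lambda>x. of_real (c * x) powr (- z) * g x) absolutely_integrable_on {0<..}"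
  shows "(\<lambda>x. of_real (exp (- (u * (c * x)))) * g x) absolutely_integrable_on {0<..}"
proof -
  let ?k = "\<lambda>x. complex_of_real (exp (- (u * (c * x)))) * of_real (c * x) powr z"
  have "continuous_on {0<..} ?k"
    using assms by (auto intro!: continuous_intros simp: complex_nonpos_Reals_iff mult_le_0_iff)
  then have meas: "?k \<in> borel_measurable (lebesgue_on {0<..})"
    by (intro continuous_imp_measurable_on_sets_lebesgue) auto
  have "norm (?k x) \<le> (Re z / u) powr Re z" if "x > 0" for x
    using powr_mult_exp_minus_le[of "Re z" u "c * x"] assms that
    by (simp add: norm_mult norm_powr_real_powr mult.commute)
  then have "bounded (?k ` {0<..})"
    by (intro boundedI) auto
  then have "(\<lambda>x. ?k x * (of_real (c * x) powr (- z) * g x)) absolutely_integrable_on {0<..}"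
    using absolutely_integrable_bounded_measurable_product[OF bilinear_times meas _ _ assms(4)]
    by simp
  also have "?this \<longleftrightarrow> ?thesis"
    using assms by (intro set_integrable_cong) (simp_all add: powr_minus)
  finally show ?thesis .
qed

text \<open>Interchanging the integrals turns the inner one into a scaled Gamma integral. Absolute
  integrability of the weighted function on the right is all that Fubini requires.\<close>

lemma mellin_laplace_integral:
  fixes g :: "real \<Rightarrow> complex" and c :: real
  assumes z: "Re z > 0" and c: "c > 0"
    and abs: "(\<lambda>x. of_real (c * x) powr (- z) * g x) absolutely_integrable_on {0<..}"
  defines "L \<equiv> \<lambda>u. integral {0<..} (\<lambda>x. of_real (exp (- (u * (c * x)))) * g x)"
  shows "mellin_converges L z"
    and "mellin L z = Gamma z * integral {0<..} (\<lambda>x. of_real (c * x) powr (- z) * g x)"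
proof -
  interpret pair_sigma_finite "lebesgue :: real measure" "lebesgue :: real measure"
    by (intro pair_sigma_finite.intro sigma_finite_lebesgue)
  \<comment> \<open>The product \<open>p z (c * x) * F x\<close> recovers \<open>g x\<close> for
    \<open>x > 0\<close> and vanishes elsewhere. Writing \<open>P\<close> through \<open>F\<close>
    makes its measurability follow from that of \<open>F\<close>, the function known to be
    integrable.\<close>
  define F where "F x = indicator {0<..} x *\<^sub>R (of_real (c * x) powr (- z) * g x)" for x
  define p where "p w r = indicator {0<..} r *\<^sub>R complex_of_real r powr w" for w r
  define P where "P x u = p z (c * x) * F x * (p (z - 1) u * of_real (exp (- (u * (c * x)))))" for x u
  have F_int: "integrable lebesgue F"
    using abs by (simp add: F_def [abs_def] set_integrable_def)
  have [measurable]: "F \<in> borel_measurable lebesgue"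
    using F_int by simp
  have [measurable]: "p w \<in> borel_measurable borel" for w
    unfolding p_def [abs_def] by (rule borel_measurable_powr_pos)
  \<comment> \<open>Composed with the projections, this gives coordinates with Borel target, to
    which the Borel functions \<open>p w\<close> and \<open>exp\<close> can be applied.\<close>
  have id: "(\<lambda>x. x) \<in> borel_measurable (lebesgue :: real measure)"
    by (rule measurable_completion) simp
  have P_meas: "case_prod P \<in> borel_measurable (lebesgue \<Otimes>\<^sub>M lebesgue)"
  proof -
    have [measurable]: "fst \<in> borel_measurable ((lebesgue :: real measure) \<Otimes>\<^sub>M (lebesgue :: real measure))"
      by (rule measurable_compose[OF measurable_fst id])
    have [measurable]: "snd \<in> borel_measurable ((lebesgue :: real measure) \<Otimes>\<^sub>M (lebesgue :: real measure))"
      by (rule measurable_compose[OF measurable_snd id])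
    show ?thesis
      unfolding P_def [abs_def] split_beta by measurable
  qed
  have P_eq: "P x u = indicator {0<..} u *\<^sub>R (of_real u powr (z - 1) *
      (indicator {0<..} x *\<^sub>R (of_real (exp (- (u * (c * x)))) * g x)))" for x u
    using c by (auto simp: P_def F_def p_def indicator_def powr_minus zero_less_mult_iff)
  have P_snd: "has_bochner_integral lebesgue (P x) (Gamma z * F x)" for x
  proof (cases "x > 0")
    case True
    then have "has_bochner_integral lebesgue (P x)
        (p z (c * x) * F x * (Gamma z * of_real (c * x) powr (- z)))"
      using has_bochner_integral_mult_right[OF has_bochner_integral_Gamma_scaled[OF z, of "c * x"],
          of "p z (c * x) * F x"] c
      by (simp add: P_def [abs_def] p_def [of "z - 1"])
    moreover have "p z (c * x) * of_real (c * x) powr (- z) = 1"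
      using True c by (simp add: p_def powr_minus)
    ultimately show ?thesis
      by (simp add: mult_ac)
  next
    case False
    then have "P x = (\<lambda>u. 0)" "F x = 0"
      by (auto simp: P_def F_def fun_eq_iff)
    then show ?thesis
      by (simp add: has_bochner_integral_zero)
  qed
  \<comment> \<open>In \<open>u\<close>, the modulus of \<open>P x u\<close> is a constant times the
    Gamma integrand with the real exponent \<open>Re z\<close>. The scaled Gamma integral at
    \<open>of_real (Re z)\<close> therefore gives a multiple of \<open>norm (F x)\<close>, which is
    integrable as Fubini demands.\<close>
  have norm_P: "(\<integral>u. norm (P x u) \<partial>lebesgue) = Gamma (Re z) * norm (F x)" for x
  proof (cases "x > 0")
    case True
    then have "has_bochner_integral lebesgue
      (\<lambda>u. norm (p z (c * x) * F x) * Re (indicator {0<..} u *\<^sub>R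
        (of_real u powr (of_real (Re z) - 1) * of_real (exp (- (u * (c * x)))))))
      (norm (p z (c * x) * F x) * Re (Gamma (of_real (Re z)) * of_real (c * x) powr (- of_real (Re z))))"
      using z c by (intro has_bochner_integral_mult_right has_bochner_integral_Re
          has_bochner_integral_Gamma_scaled) auto
    moreover have "norm (p z (c * x) * F x) * Re (indicator {0<..} u *\<^sub>R
        (of_real u powr (of_real (Re z) - 1) * of_real (exp (- (u * (c * x)))))) = norm (P x u)" for u
    proof (cases "u > 0")
      case True
      then have "complex_of_real u powr (of_real (Re z) - 1) = of_real (u powr (Re z - 1))"
        using powr_of_real[of u "Re z - 1"] by simp
      then show ?thesis
        using True by (simp add: P_def p_def [of "z - 1"] norm_mult norm_powr_real_powr)
    qed (simp add: P_def p_def [of "z - 1"])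
    moreover have "complex_of_real (c * x) powr (- of_real (Re z)) = of_real ((c * x) powr (- Re z))"
      using powr_of_real[of "c * x" "- Re z"] True c by simp
    then have "norm (p z (c * x) * F x) *
        Re (Gamma (of_real (Re z)) * of_real (c * x) powr (- of_real (Re z))) =
        norm (p z (c * x)) * (c * x) powr (- Re z) * (Gamma (Re z) * norm (F x))"
      by (simp add: norm_mult Gamma_complex_of_real del: of_real_mult)
    moreover have "norm (p z (c * x)) * (c * x) powr (- Re z) = 1"
      using True c by (simp add: p_def norm_powr_real_powr flip: powr_add del: of_real_mult)
    ultimately have "has_bochner_integral lebesgue (\<lambda>u. norm (P x u)) (Gamma (Re z) * norm (F x))"
      by (simp only: mult_1_left)
    then show ?thesis
      by (simp add: has_bochner_integral_iff)
  next
    case False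
    then show ?thesis
      by (simp add: P_def F_def)
  qed
  have P_int: "integrable (lebesgue \<Otimes>\<^sub>M lebesgue) (case_prod P)"
  proof (rule Fubini_integrable[OF P_meas])
    show "integrable lebesgue (\<lambda>x. \<integral>u. norm (case_prod P (x, u)) \<partial>lebesgue)"
      using F_int by (simp add: norm_P)
    show "AE x in lebesgue. integrable lebesgue (\<lambda>u. case_prod P (x, u))"
      using P_snd by (simp add: has_bochner_integral_iff)
  qed
  \<comment> \<open>The identity holds for every \<open>u\<close>, not just almost every one,
    because \<open>absolutely_integrable_exp_mult\<close> applies to each
    \<open>u > 0\<close>.\<close>
  have P_fst: "(\<integral>x. P x u \<partial>lebesgue) = indicator {0<..} u *\<^sub>R (of_real u powr (z - 1) * L u)" for u
  proof (cases "u > 0")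
    case True
    then show ?thesis
      using set_lebesgue_integral_eq_integral(2)[OF absolutely_integrable_exp_mult[OF z c True abs]]
      by (simp add: P_eq L_def set_lebesgue_integral_def del: mult_scaleR_right)
  qed (simp add: P_eq)
  have "integrable lebesgue (\<lambda>u. \<integral>x. P x u \<partial>lebesgue)"
    by (rule integrable_snd[OF P_int])
  then have conv: "(\<lambda>u. of_real u powr (z - 1) * L u) absolutely_integrable_on {0<..}"
    by (simp add: P_fst set_integrable_def)
  then show "mellin_converges L z"
    by (simp add: mellin_converges_def)
  have "mellin L z = (\<integral>u. (\<integral>x. P x u \<partial>lebesgue) \<partial>lebesgue)"
    using set_lebesgue_integral_eq_integral(2)[OF conv]
    by (simp add: mellin_def P_fst set_lebesgue_integral_def)
  also have "\<dots> = (\<integral>x. (\<integral>u. P x u \<partial>lebesgue) \<partial>lebesgue)"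
    by (rule Fubini_integral[OF P_int])
  also have "\<dots> = Gamma z * integral\<^sup>L lebesgue F"
    using P_snd by (simp add: has_bochner_integral_iff)
  also have "integral\<^sup>L lebesgue F = integral {0<..} (\<lambda>x. of_real (c * x) powr (- z) * g x)"
    using set_lebesgue_integral_eq_integral(2)[OF abs]
    by (simp add: F_def [abs_def] set_lebesgue_integral_def)
  finally show "mellin L z = Gamma z * integral {0<..} (\<lambda>x. of_real (c * x) powr (- z) * g x)" .
qed

section \<open>Measurability and decay of the integrand of \<open>M_transform\<close>\<close>

lemma M_integrand_measurable:
  assumes "f \<in> borel_measurable (lebesgue_on {0<..})" "\<omega> > 0"
  shows "M_integrand \<rho> m f u v \<omega> \<in> borel_measurable (lebesgue_on {0<..})"
proof -
  \<comment> \<open>Extending \<open>f\<close> by zero to the whole line allows scaling by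
    \<open>\<omega>\<close>, which preserves the half-line as \<open>\<omega> > 0\<close>.\<close>
  have "(\<lambda>x. indicator {0<..} x *\<^sub>R f x) \<in> borel_measurable lebesgue"
    using assms(1) by (simp add: borel_measurable_restrict_space_iff)
  then have "(\<lambda>x. indicator {0<..} (\<omega> *\<^sub>R x) *\<^sub>R f (\<omega> *\<^sub>R x)) \<in> borel_measurable lebesgue"
    by (rule measurable_compose[OF lebesgue_measurable_scaling])
  also have "(\<lambda>x. indicator {0<..} (\<omega> *\<^sub>R x) *\<^sub>R f (\<omega> *\<^sub>R x)) = (\<lambda>x. indicator {0<..} x *\<^sub>R f (\<omega> * x))"
    using assms(2) by (auto simp: indicator_def zero_less_mult_iff)
  finally have f: "(\<lambda>x. f (\<omega> * x)) \<in> borel_measurable (lebesgue_on {0<..})"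
    by (simp add: borel_measurable_restrict_space_iff)
  have "x ^ m + \<omega> ^ m > 0" if "x > 0" for x
    using that assms(2) by (simp add: add_pos_pos)
  then have "continuous_on {0<..} (\<lambda>x. exp (- u * of_real x - v / of_real x) / of_real (x ^ m + \<omega> ^ m) powr \<rho>)"
    by (force intro!: continuous_intros simp: complex_nonpos_Reals_iff simp flip: of_real_power of_real_add)
  then have "(\<lambda>x. exp (- u * of_real x - v / of_real x) / of_real (x ^ m + \<omega> ^ m) powr \<rho>)
      \<in> borel_measurable (lebesgue_on {0<..})"
    by (intro continuous_imp_measurable_on_sets_lebesgue) auto
  with f show ?thesis
    unfolding M_integrand_def [abs_def] by (rule borel_measurable_times[rotated])
qed

text \<open>The denominator absorbs the power of \<open>x\<close> in the growth bound, while
  \<open>exp (- v / x)\<close> and \<open>(\<omega> * x) powr (- z)\<close> stay bounded beyond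
  \<open>T / \<omega>\<close>. What remains is an exponential with negative rate.\<close>

lemma M_integrand_integrable_at_infinity:
  fixes \<rho> v z :: complex and \<omega> a K T \<beta> :: real
  assumes "Re \<rho> > 0" "\<omega> > 0" "Re z > 0" "K > 0" "T > 0" "a > 1 / \<beta>"
    and measurable: "f \<in> borel_measurable (lebesgue_on {0<..})"
    and growth: "\<And>x. x > T \<Longrightarrow> cmod (f x) \<le> K * x powr (real m * Re \<rho>) * exp (x / \<beta>)"
  shows "M_integrand \<rho> m (\<lambda>x. of_real x powr (- z) * f x) (of_real (a * \<omega>)) v \<omega>
    absolutely_integrable_on {T / \<omega><..}" (is "?M absolutely_integrable_on ?S")
proof -
  \<comment> \<open>\<open>\<delta>\<close> is the net decay rate of
    \<open>exp (- (a * \<omega> * x))\<close> against \<open>exp (\<omega> * x / \<beta>)\<close>.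
    \<open>C\<close> collects the bounds on the other factors.\<close>
  define \<delta> where "\<delta> = (a - 1 / \<beta>) * \<omega>"
  define C where "C = exp (cmod v * \<omega> / T) * (T powr (- Re z) * (K * \<omega> powr (real m * Re \<rho>)))"
  have \<delta>: "\<delta> > 0"
    using assms by (simp add: \<delta>_def)
  have sub: "?S \<subseteq> {0<..}"
    using assms by (auto intro: less_trans[of _ "T / \<omega>"])
  have "(\<lambda>x. complex_of_real x powr (- z)) \<in> borel_measurable (lebesgue_on {0<..})"
    by (intro continuous_imp_measurable_on_sets_lebesgue)
       (auto intro!: continuous_intros simp: complex_nonpos_Reals_iff)
  then have "?M \<in> borel_measurable (lebesgue_on {0<..})"
    using measurable assms(2) by (intro M_integrand_measurable borel_measurable_times)
  then have meas: "?M \<in> borel_measurable (lebesgue_on ?S)"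
    using sub by (rule measurable_restrict_mono)
  have "(\<lambda>x. exp (- \<delta> * x)) integrable_on {T / \<omega>..}"
    by (rule integrable_on_exp_minus_to_infinity[OF \<delta>])
  then have "(\<lambda>x. exp (- \<delta> * x)) integrable_on ?S"
    by (rule integrable_spike_set) (auto intro: negligible_subset[of "{T / \<omega>}"])
  then have bound_int: "(\<lambda>x. C * exp (- \<delta> * x)) integrable_on ?S"
    by (rule integrable_on_mult_right)
  have bound: "norm (?M x) \<le> C * exp (- \<delta> * x)" if "x \<in> ?S" for x
  proof -
    have "x > 0"
      using subsetD[OF sub that] by simp
    moreover have "\<omega> * x > T"
      using that \<open>\<omega> > 0\<close> by (simp add: pos_divide_less_eq mult.commute)
    ultimately have x: "x > 0" "\<omega> * x > T" .
    have "x ^ m > 0" "\<omega> ^ m > 0"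
      using x assms by auto
    \<comment> \<open>The sign of \<open>Re v\<close> is arbitrary, so the factor involving
      \<open>v / x\<close> is controlled by \<open>cmod v\<close> and
      \<open>x > T / \<omega>\<close>.\<close>
    have "- Re (v / of_real x) \<le> cmod (v / of_real x)"
      using abs_Re_le_cmod[of "v / of_real x"] by linarith
    also have "\<dots> = cmod v / x"
      using x by (simp add: norm_divide)
    also have "\<dots> \<le> cmod v * \<omega> / T"
      using mult_right_mono[of T "\<omega> * x" "cmod v"] x assms by (simp add: field_simps)
    finally have 1: "norm (exp (- of_real (a * \<omega>) * of_real x - v / of_real x))
        \<le> exp (- (a * \<omega> * x)) * exp (cmod v * \<omega> / T)"
      by (simp flip: exp_add)
    have "x powr (real m * Re \<rho>) = (x ^ m) powr Re \<rho>"
      using x by (simp add: powr_powr flip: powr_realpow)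
    also have "\<dots> \<le> (x ^ m + \<omega> ^ m) powr Re \<rho>"
      using \<open>x ^ m > 0\<close> \<open>\<omega> ^ m > 0\<close> assms by (intro powr_mono2) auto
    also have "\<dots> = norm (of_real (x ^ m + \<omega> ^ m) powr \<rho>)"
      using \<open>x ^ m > 0\<close> \<open>\<omega> ^ m > 0\<close> by (subst norm_powr_real_powr) auto
    finally have 2: "x powr (real m * Re \<rho>) \<le> norm (of_real (x ^ m + \<omega> ^ m) powr \<rho>)" .
    have 3: "norm (of_real (\<omega> * x) powr (- z)) \<le> T powr (- Re z)"
      using x assms by (simp add: norm_powr_real_powr powr_mono2' del: of_real_mult)
    have 4: "norm (f (\<omega> * x)) \<le> K * \<omega> powr (real m * Re \<rho>) * x powr (real m * Re \<rho>) * exp (\<omega> * x / \<beta>)"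
      using growth[OF x(2)] x assms by (simp add: powr_mult mult_ac)
    have "norm (?M x) \<le> exp (- (a * \<omega> * x)) * exp (cmod v * \<omega> / T) / x powr (real m * Re \<rho>) *
        (T powr (- Re z) * (K * \<omega> powr (real m * Re \<rho>) * x powr (real m * Re \<rho>) * exp (\<omega> * x / \<beta>)))"
      unfolding M_integrand_def norm_mult norm_divide
      using x assms by (intro mult_mono frac_le 1 2 3 4) auto
    also have "\<dots> = C * (exp (- (a * \<omega> * x)) * exp (\<omega> * x / \<beta>))"
      using x by (simp add: C_def field_simps)
    also have "exp (- (a * \<omega> * x)) * exp (\<omega> * x / \<beta>) = exp (- \<delta> * x)"
      by (simp add: \<delta>_def algebra_simps flip: exp_add)
    finally show ?thesis .
  qed
  show ?thesis
    by (rule measurable_bounded_by_integrable_imp_absolutely_integrable[OF meas _ bound_int bound]) auto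
qed

theorem corollary3p2:
  fixes \<rho> v z :: complex and m :: nat and \<omega> a K T \<beta> :: real and f :: "real \<Rightarrow> complex"
  assumes "Re \<rho> > 0" and "m \<ge> 1" and "\<omega> > 0" and "a > 0" and "Re z > 0"
    and "K > 0" and "T > 0" and "\<beta> > 0"
    and measurable: "f \<in> borel_measurable (lebesgue_on {0<..})"
    and growth: "\<And>x. x > T \<Longrightarrow> cmod (f x) \<le> K * x powr (real m * Re \<rho>) * exp (x / \<beta>)"
    and conv_at_0:
      "M_integrand \<rho> m (\<lambda>x. of_real x powr (- z) * f x) (of_real (a * \<omega>)) v \<omega>
         absolutely_integrable_on {0<..T / \<omega>}"
    and conv_at_infinity:
      "a \<le> 1 / \<beta> \<Longrightarrow>
       M_integrand \<rho> m (\<lambda>x. of_real x powr (- z) * f x) (of_real (a * \<omega>)) v \<omega>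
         absolutely_integrable_on {T / \<omega><..}"
  shows "M_converges \<rho> m (\<lambda>x. of_real x powr (- z) * f x) (of_real (a * \<omega>)) v \<omega>
    \<and> (\<forall>u>0. M_converges \<rho> m (\<lambda>x. of_real (exp (- a * x)) * f x) (of_real (u * \<omega>)) v \<omega>)
    \<and> mellin_converges
           (\<lambda>u. M_transform \<rho> m (\<lambda>x. of_real (exp (- a * x)) * f x) (of_real (u * \<omega>)) v \<omega>) z
    \<and> mellin
           (\<lambda>u. M_transform \<rho> m (\<lambda>x. of_real (exp (- a * x)) * f x) (of_real (u * \<omega>)) v \<omega>) z
         = Gamma z * M_transform \<rho> m (\<lambda>x. of_real x powr (- z) * f x) (of_real (a * \<omega>)) v \<omega>"
proof -
  let ?E = "\<lambda>x. of_real (exp (- a * x)) * f x" and ?Z = "\<lambda>x. of_real x powr (- z) * f x"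
  define g where "g = M_integrand \<rho> m ?E 0 v \<omega>"
  \<comment> \<open>Since functions are evaluated at \<open>\<omega> * x\<close>, the factor
    \<open>exp (- a * x)\<close> contributes \<open>exp (- (a * \<omega> * x))\<close> to
    \<open>g\<close>. The same factor arises in \<open>Z_eq\<close> from the first argument
    \<open>a * \<omega>\<close>, so both transforms share \<open>g\<close>.\<close>
  have E_eq: "M_integrand \<rho> m ?E (of_real (u * \<omega>)) v \<omega> = (\<lambda>x. of_real (exp (- (u * (\<omega> * x)))) * g x)" for u
    by (simp add: g_def M_integrand_def fun_eq_iff exp_diff exp_minus field_simps flip: exp_of_real)
  have Z_eq: "M_integrand \<rho> m ?Z (of_real (a * \<omega>)) v \<omega> = (\<lambda>x. of_real (\<omega> * x) powr (- z) * g x)"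
    by (simp add: g_def M_integrand_def fun_eq_iff exp_diff exp_minus field_simps flip: exp_of_real)
  \<comment> \<open>For \<open>a \<le> 1 / \<beta>\<close> this is the assumed convergence; for
    larger \<open>a\<close> it follows from the growth bound.\<close>
  have "M_integrand \<rho> m ?Z (of_real (a * \<omega>)) v \<omega> absolutely_integrable_on {T / \<omega><..}"
    using conv_at_infinity M_integrand_integrable_at_infinity[of \<rho> \<omega> z K T \<beta> a f m v] assms by fastforce
  with conv_at_0 have "M_integrand \<rho> m ?Z (of_real (a * \<omega>)) v \<omega>
      absolutely_integrable_on ({0<..T / \<omega>} \<union> {T / \<omega><..})"
    by (intro set_integrable_Un) auto
  also have "{0<..T / \<omega>} \<union> {T / \<omega><..} = {0<..}"
    using assms by (auto intro: less_trans[of _ "T / \<omega>"])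
  finally have conv: "(\<lambda>x. of_real (\<omega> * x) powr (- z) * g x) absolutely_integrable_on {0<..}"
    unfolding Z_eq .
  show ?thesis
    unfolding M_converges_def M_transform_def E_eq Z_eq
    using conv absolutely_integrable_exp_mult[OF \<open>Re z > 0\<close> \<open>\<omega> > 0\<close> _ conv]
      mellin_laplace_integral[OF \<open>Re z > 0\<close> \<open>\<omega> > 0\<close> conv] by blast
qed

end
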